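(* Let $\mathcal{X}$ be a real Hilbert space, let $f$, $g$, $\Psi=f+g$ and the constants $L_f>0$, $\mu_f\ge 0$, $\mu_g\ge 0$ be as in the context, let $x^\star\in\arg\min\Psi$ and $\Psi^\star=\Psi(x^\star)$. Let $(x^t),(y^t),(z^t)$ be the iterates of the algorithm APGD (see context) with stepsize $\gamma>0$ and parameters $(a_t)_{t\ge 0}$, $a_0\ge 0$ and $a_t\ge 1$ for every $t\ge 1$. Then for every $t\ge 0$, $$\frac{1+a_{t+1}\gamma\mu_g}{2\gamma}\|z^{t+1}-x^\star\|^2+a_{t+1}^2\big(\Psi(x^{t+1})-\Psi^\star\big)\le \frac{1-\gamma\mu_f}{2\gamma}\|z^{t}-x^\star\|^2+(a_{t+1}^2-a_{t+1})\big(\Psi(x^{t})-\Psi^\star\big)-\Big(\frac{1}{2\gamma}-\frac{L_f}{2}\Big)\|z^{t+1}-z^t\|^2.$$ Consequently, defining for every $t\ge 0$ $$\mathcal{E}^t_{x^\star}:=\frac{1+a_{t}\gamma\mu_g}{2\gamma}\|z^{t}-x^\star\|^2+a_{t}^2\big(\Psi(x^{t})-\Psi^\star\big),$$ if $\gamma\le \frac{1}{L_f}$, then for every $t\ge 0$, $$\mathcal{E}^{t+1}_{x^\star}\le \max\left(\frac{1-\gamma\mu_f}{1+a_{t}\gamma\mu_g},\frac{a_{t+1}^2-a_{t+1}}{a_t^2}\right)\mathcal{E}^t_{x^\star}.$$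
   Context: Setting: $\mathcal{X}$ is a real Hilbert space; $f:\mathcal{X}\to\mathbb{R}$ is convex, differentiable and $L_f$-smooth (i.e. $\nabla f$ is $L_f$-Lipschitz continuous) with $L_f>0$; $g:\mathcal{X}\to\mathbb{R}\cup\{+\infty\}$ is proper, lower semicontinuous and convex. For a convex function $\phi$, $\mu_\phi\ge 0$ denotes a constant such that $\phi-\frac{\mu_\phi}{2}\|\cdot\|^2$ is convex ($\mu_\phi$-strong convexity, $\mu_\phi=0$ allowed). $\Psi:=f+g$ is assumed to have a minimizer. The proximity operator is $\mathrm{prox}_\phi(x):=\arg\min_{y}\{\phi(y)+\frac12\|y-x\|^2\}$. APGD (Accelerated Proximal Gradient Descent): given $\gamma>0$, a real sequence $(a_t)_{t\ge0}$ with $a_t\ge 1$ for every $t\ge 1$, and $z^0=x^0\in\mathcal{X}$, iterate for $t\ge 0$: $y^{t}:=(1-\frac{1}{a_{t+1}})x^{t}+\frac{1}{a_{t+1}}z^{t}$; $z^{t+1}:=\mathrm{prox}_{a_{t+1}\gamma g}\big(z^t-a_{t+1}\gamma\nabla f(y^t)\big)$; $x^{t+1}:=(1-\frac{1}{a_{t+1}})x^{t}+\frac{1}{a_{t+1}}z^{t+1}$. Conventions: $0\cdot(+\infty)=0$. If $a_0=0$, the ratio $\frac{a_1^2-a_1}{a_0^2}$ is read as $0$ when $a_1=1$ and as $+\infty$ when $a_1>1$. *)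

theory Defs
  imports "HOL-Analysis.Analysis"
begin

text \<open>
  Extended-valued functions take values in \<^typ>\<open>ereal\<close>, whose arithmetic satisfies
  \<open>0 * \<infinity> = 0\<close>.
\<close>

definition proper :: "('a \<Rightarrow> ereal) \<Rightarrow> bool" where
  "proper \<phi> \<longleftrightarrow> (\<forall>x. \<phi> x \<noteq> -\<infinity>) \<and> (\<exists>x. \<phi> x \<noteq> \<infinity>)"

definition lower_semicontinuous :: "('a::topological_space \<Rightarrow> ereal) \<Rightarrow> bool" where
  "lower_semicontinuous \<phi> \<longleftrightarrow> (\<forall>x. \<phi> x \<le> Liminf (at x) \<phi>)"

text \<open>
  The library's \<^const>\<open>convex_on\<close> covers real-valued functions only. The inequality below is used
  for functions that never take the value \<open>-\<infinity>\<close>, so its right-hand side is well defined.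
\<close>

definition convex_ereal :: "('a::real_vector \<Rightarrow> ereal) \<Rightarrow> bool" where
  "convex_ereal \<phi> \<longleftrightarrow> (\<forall>x y. \<forall>u\<ge>0. \<forall>v\<ge>0. u + v = 1 \<longrightarrow>
     \<phi> (u *\<^sub>R x + v *\<^sub>R y) \<le> ereal u * \<phi> x + ereal v * \<phi> y)"

text \<open>
  For proper lower semicontinuous convex \<open>\<phi>\<close> on a Hilbert space the minimizer exists and is
  unique, so the choice made by \<^const>\<open>arg_min\<close> is immaterial.
\<close>

definition prox :: "('a::real_normed_vector \<Rightarrow> ereal) \<Rightarrow> 'a \<Rightarrow> 'a" where
  "prox \<phi> x = arg_min (\<lambda>y. \<phi> y + ereal (1 / 2 * (norm (y - x))\<^sup>2)) (\<lambda>_. True)"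

text \<open>The argument \<open>df\<close> is the gradient of the smooth part.\<close>

definition apgd_iterates ::
  "('a::real_normed_vector \<Rightarrow> 'a) \<Rightarrow> ('a \<Rightarrow> ereal) \<Rightarrow> real \<Rightarrow> (nat \<Rightarrow> real)
    \<Rightarrow> (nat \<Rightarrow> 'a) \<Rightarrow> (nat \<Rightarrow> 'a) \<Rightarrow> (nat \<Rightarrow> 'a) \<Rightarrow> bool" where
  "apgd_iterates df g \<gamma> a x y z \<longleftrightarrow> z 0 = x 0 \<and>
     (\<forall>t. y t = (1 - 1 / a (Suc t)) *\<^sub>R x t + (1 / a (Suc t)) *\<^sub>R z t \<and>
          z (Suc t) = prox (\<lambda>u. ereal (a (Suc t) * \<gamma>) * g u)
                        (z t - (a (Suc t) * \<gamma>) *\<^sub>R df (y t)) \<and>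
          x (Suc t) = (1 - 1 / a (Suc t)) *\<^sub>R x t + (1 / a (Suc t)) *\<^sub>R z (Suc t))"

definition energy ::
  "('a::real_normed_vector \<Rightarrow> ereal) \<Rightarrow> real \<Rightarrow> real \<Rightarrow> (nat \<Rightarrow> real)
    \<Rightarrow> (nat \<Rightarrow> 'a) \<Rightarrow> (nat \<Rightarrow> 'a) \<Rightarrow> 'a \<Rightarrow> nat \<Rightarrow> ereal" where
  "energy \<Psi> \<gamma> \<mu>\<^sub>g a x z xs t =
     ereal ((1 + a t * \<gamma> * \<mu>\<^sub>g) / (2 * \<gamma>) * (norm (z t - xs))\<^sup>2)
     + ereal ((a t)\<^sup>2) * (\<Psi> (x t) - \<Psi> xs)"

text \<open>
  Division is that of \<^typ>\<open>ereal\<close>: for \<open>a t = 0\<close> it gives \<open>0\<close> if \<open>a (Suc t) = 1\<close> and \<open>\<infinity>\<close> if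
  \<open>a (Suc t) > 1\<close>.
\<close>

definition momentum_ratio :: "(nat \<Rightarrow> real) \<Rightarrow> nat \<Rightarrow> ereal" where
  "momentum_ratio a t = ereal ((a (Suc t))\<^sup>2 - a (Suc t)) / ereal ((a t)\<^sup>2)"

end

theory Submission
  imports Defs
begin

text \<open>
  The prox step minimizes a \<open>(1 + a\<gamma>\<mu>\<^sub>g)\<close>-strongly convex function, which gives a quadratic lower
  bound for its objective at \<open>xs\<close>. To this one adds the descent inequality for \<open>f\<close> between \<open>y t\<close> and
  \<open>x (Suc t)\<close> with weight \<open>a\<^sup>2\<close>, the tangent inequalities for \<open>f\<close> at \<open>y t\<close> towards \<open>xs\<close> and \<open>x t\<close> with
  weights \<open>a\<close> and \<open>a\<^sup>2 - a\<close>, and convexity of \<open>g\<close>. The gradient terms cancel because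
  \<open>a (y t) = (a - 1) (x t) + z t\<close>. The energy estimate compares the two nonnegative terms separately.
\<close>

section \<open>Convexity and lower semicontinuity for extended values\<close>

text \<open>Two finite end values force a finite value in between, so later convexity estimates can
  be carried out in real arithmetic.\<close>

lemma convex_erealD:
  assumes "convex_ereal \<phi>" "\<And>w. \<phi> w \<noteq> -\<infinity>" "0 \<le> u" "0 \<le> v" "u + v = 1"
    and "\<phi> x = ereal r" "\<phi> y = ereal s"
  obtains q where "\<phi> (u *\<^sub>R x + v *\<^sub>R y) = ereal q" "q \<le> u * r + v * s"
proof -
  have "\<phi> (u *\<^sub>R x + v *\<^sub>R y) \<le> ereal (u * r + v * s)"
    using assms unfolding convex_ereal_def by (metis plus_ereal.simps(1) times_ereal.simps(1))
  then show ?thesis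
    using that assms(2)[of "u *\<^sub>R x + v *\<^sub>R y"] by (cases "\<phi> (u *\<^sub>R x + v *\<^sub>R y)") auto
qed

lemma lower_semicontinuous_eventually:
  assumes "lower_semicontinuous \<phi>" "c < \<phi> x"
  shows "eventually (\<lambda>u. c < \<phi> u) (nhds x)"
proof -
  have "eventually (\<lambda>u. c < \<phi> u) (at x)"
    using assms le_Liminf_iff[of "\<phi> x" "at x" \<phi>] unfolding lower_semicontinuous_def by blast
  then show ?thesis
    using assms(2) by (simp add: eventually_nhds_conv_at)
qed

text \<open>The defect \<open>s * (1 - s) * (norm (u - p))\<^sup>2\<close> is the exact strong
  convexity of the square. It yields both the Cauchy estimate for minimizing sequences and the
  quadratic growth at a proximal point.\<close>

lemma norm_convex_comb_square:
  fixes p u w :: "'a::real_inner"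
  shows "(norm ((1 - s) *\<^sub>R p + s *\<^sub>R u - w))\<^sup>2 =
    (1 - s) * (norm (p - w))\<^sup>2 + s * (norm (u - w))\<^sup>2 - s * (1 - s) * (norm (u - p))\<^sup>2"
  unfolding power2_norm_eq_inner inner_diff_left inner_diff_right inner_add_left inner_add_right
    inner_scaleR_left inner_scaleR_right inner_commute[of w p] inner_commute[of w u] inner_commute[of u p]
  by (simp add: algebra_simps)

section \<open>Proximal points: existence and quadratic growth\<close>

text \<open>Lower semicontinuity keeps \<phi> above \<open>c - 1\<close> on a small ball. A steeper
  descent further out would, by convexity along the ray, already push \<phi> below
  \<open>c - 1\<close> on the bounding sphere. In what follows this bound takes the place of an
  affine minorant.\<close>

lemma convex_ereal_norm_lower_bound:
  fixes \<phi> :: "'a::real_normed_vector \<Rightarrow> ereal"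
  assumes "\<And>w. \<phi> w \<noteq> -\<infinity>" "lower_semicontinuous \<phi>" "convex_ereal \<phi>" "\<phi> x\<^sub>0 = ereal c"
  obtains K where "K \<ge> 0" "\<And>u. \<phi> u \<ge> ereal (c - 1 - K * norm (u - x\<^sub>0))"
proof -
  have "eventually (\<lambda>u. ereal (c - 1) < \<phi> u) (nhds x\<^sub>0)"
    using assms by (intro lower_semicontinuous_eventually) auto
  then obtain e where e: "e > 0" "\<And>u. dist u x\<^sub>0 < e \<Longrightarrow> ereal (c - 1) < \<phi> u"
    unfolding eventually_nhds_metric by blast
  define r where "r = e / 2"
  have r: "r > 0" "\<And>u. norm (u - x\<^sub>0) \<le> r \<Longrightarrow> ereal (c - 1) < \<phi> u"
    using e by (auto simp: r_def dist_norm)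
  have "\<phi> u \<ge> ereal (c - 1 - 1 / r * norm (u - x\<^sub>0))" for u
  proof (cases "norm (u - x\<^sub>0) \<le> r")
    case True
    then show ?thesis
      using r(2)[of u] r(1) by (intro order.trans[OF _ less_imp_le[OF r(2)]]) auto
  next
    case False
    show ?thesis
    proof (cases "\<phi> u")
      case (real k)
      \<comment> \<open>This weight puts \<open>v\<close> on the sphere of radius \<open>r\<close>,
        and \<open>1 / s\<close> is the distance of \<open>u\<close> measured in units of
        \<open>r\<close>, hence the slope \<open>1 / r\<close>.\<close>
      define s where "s = r / norm (u - x\<^sub>0)"
      have pos: "norm (u - x\<^sub>0) > 0" using False r(1) by linarith
      then have s: "0 < s" "s \<le> 1" using pos False r(1) by (simp_all add: s_def)
      define v where "v = (1 - s) *\<^sub>R x\<^sub>0 + s *\<^sub>R u"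
      obtain q where q: "\<phi> v = ereal q" "q \<le> (1 - s) * c + s * k"
        using convex_erealD[OF assms(3) assms(1), of "1 - s" s x\<^sub>0 c u k] s assms(4) real
        by (auto simp: v_def)
      have "v - x\<^sub>0 = s *\<^sub>R (u - x\<^sub>0)" by (simp add: v_def algebra_simps)
      then have "norm (v - x\<^sub>0) = r" using pos r(1) by (simp add: s_def)
      then have "c - 1 < q" using r(2)[of v] q by simp
      then have "s * (c - k) < 1" using q(2) by (simp add: algebra_simps)
      then have "c - k < 1 / s" using s(1) by (simp add: field_simps)
      then have "k \<ge> c - 1 - 1 / r * norm (u - x\<^sub>0)" by (simp add: s_def)
      then show ?thesis using real by simp
    qed (use assms(1) in auto)
  qed
  then show ?thesis using that[of "1 / r"] r(1) by simp
qed

text \<open>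
  By strong convexity of the quadratic term, minimizing sequences are Cauchy, so no weak
  compactness is needed.
\<close>

lemma prox_objective_minimizer_exists:
  fixes \<phi> :: "'a::{real_inner, complete_space} \<Rightarrow> ereal"
  assumes "proper \<phi>" "lower_semicontinuous \<phi>" "convex_ereal \<phi>"
  shows "\<exists>p. is_arg_min (\<lambda>y. \<phi> y + ereal (1 / 2 * (norm (y - w))\<^sup>2)) (\<lambda>_. True) p"
proof -
  have nm: "\<phi> u \<noteq> -\<infinity>" for u using assms(1) by (auto simp: proper_def)
  obtain x\<^sub>0 c where x0: "\<phi> x\<^sub>0 = ereal c"
    using assms(1) unfolding proper_def by (metis ereal_cases)
  obtain K where K: "K \<ge> 0" "\<And>u. \<phi> u \<ge> ereal (c - 1 - K * norm (u - x\<^sub>0))"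
    using convex_ereal_norm_lower_bound[OF nm assms(2,3) x0] by blast
  define h where "h y = \<phi> y + ereal (1 / 2 * (norm (y - w))\<^sup>2)" for y
  \<comment> \<open>After the triangle inequality it remains to minimize
    \<open>t\<^sup>2 / 2 - K * t\<close> over \<open>t = norm (u - w)\<close>; the minimum is
    \<open>- K\<^sup>2 / 2\<close>.\<close>
  define B where "B = c - 1 - K * norm (w - x\<^sub>0) - K\<^sup>2 / 2"
  have hB: "ereal B \<le> h u" for u
  proof -
    have "norm (u - x\<^sub>0) \<le> norm (u - w) + norm (w - x\<^sub>0)"
      using norm_triangle_ineq[of "u - w" "w - x\<^sub>0"] by simp
    then have "K * norm (u - x\<^sub>0) \<le> K * (norm (u - w) + norm (w - x\<^sub>0))"
      using K(1) by (rule mult_left_mono)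
    moreover have "0 \<le> (norm (u - w) - K)\<^sup>2" by simp
    ultimately have "B \<le> c - 1 - K * norm (u - x\<^sub>0) + 1 / 2 * (norm (u - w))\<^sup>2"
      by (simp add: B_def power2_diff algebra_simps)
    then have "ereal B \<le> ereal (c - 1 - K * norm (u - x\<^sub>0)) + ereal (1 / 2 * (norm (u - w))\<^sup>2)"
      by simp
    also have "\<dots> \<le> h u"
      unfolding h_def by (rule add_right_mono[OF K(2)])
    finally show ?thesis .
  qed
  define M where "M = (INF u. h u)"
  have "ereal B \<le> M" unfolding M_def using hB by (simp add: INF_greatest)
  moreover have "M \<le> h x\<^sub>0" unfolding M_def by (rule INF_lower) simp
  moreover have "h x\<^sub>0 < \<infinity>" using x0 by (simp add: h_def)
  ultimately obtain m where m: "M = ereal m" by (cases M) auto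
  have hm: "ereal m \<le> h u" for u using m unfolding M_def by (metis INF_lower UNIV_I)
  have "\<exists>u. h u < ereal (m + 1 / real (Suc n))" for n
  proof -
    have "M < ereal (m + 1 / real (Suc n))" using m by simp
    then show ?thesis unfolding M_def by (simp add: INF_less_iff)
  qed
  then obtain u where u: "\<And>n. h (u n) < ereal (m + 1 / real (Suc n))" by metis
  have "\<exists>k. \<phi> (u n) = ereal k" for n
    using u[of n] nm[of "u n"] by (cases "\<phi> (u n)") (auto simp: h_def)
  then obtain k where k: "\<And>n. \<phi> (u n) = ereal (k n)" by metis
  have ku: "k n + 1 / 2 * (norm (u n - w))\<^sup>2 < m + 1 / real (Suc n)" for n
    using u[of n] k[of n] by (simp add: h_def)
  \<comment> \<open>The midpoint of two near-minimizers cannot go below the infimum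
    \<open>m\<close>, but the square drops there by an eighth of the squared distance. Hence that
    distance is controlled by the two excesses.\<close>
  have gap: "(norm (u i - u j))\<^sup>2 \<le> 4 * (1 / real (Suc i) + 1 / real (Suc j))" for i j
  proof -
    define v where "v = (1 - 1 / 2) *\<^sub>R u j + (1 / 2) *\<^sub>R u i"
    obtain q where q: "\<phi> v = ereal q" "q \<le> (1 - 1 / 2) * k j + 1 / 2 * k i"
      using convex_erealD[OF assms(3) nm, of "1 - 1 / 2" "1 / 2" "u j" "k j" "u i" "k i"] k
      by (auto simp: v_def)
    have "m \<le> q + 1 / 2 * (norm (v - w))\<^sup>2" using hm[of v] q by (simp add: h_def)
    moreover have "(norm (v - w))\<^sup>2 = 1 / 2 * (norm (u j - w))\<^sup>2 + 1 / 2 * (norm (u i - w))\<^sup>2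
        - 1 / 4 * (norm (u i - u j))\<^sup>2"
      unfolding v_def norm_convex_comb_square by simp
    ultimately show ?thesis using q(2) ku[of i] ku[of j] by (simp add: algebra_simps)
  qed
  have "Cauchy u"
  proof (rule metric_CauchyI)
    fix e :: real assume e: "e > 0"
    \<comment> \<open>Both excesses are at most \<open>1 / real (Suc N)\<close>, so the bound
      \<open>gap\<close> is at most eight times this number.\<close>
    then obtain N where N: "1 / real (Suc N) < e\<^sup>2 / 8"
      using nat_approx_posE[of "e\<^sup>2 / 8"] by auto
    have "dist (u i) (u j) < e" if "i \<ge> N" "j \<ge> N" for i j
    proof -
      have "1 / real (Suc i) \<le> 1 / real (Suc N)" "1 / real (Suc j) \<le> 1 / real (Suc N)"
        using that by (auto intro!: divide_left_mono)
      moreover have "G < E" if "p \<le> r" "q \<le> r" "G \<le> 4 * (p + q)" "r < E / 8" for p q r G E :: real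
        using that by simp
      ultimately have "(norm (u i - u j))\<^sup>2 < e\<^sup>2" using gap[of i j] N by blast
      then show ?thesis using e by (simp add: dist_norm power_less_imp_less_base)
    qed
    then show "\<exists>N. \<forall>i\<ge>N. \<forall>j\<ge>N. dist (u i) (u j) < e" by blast
  qed
  then obtain p where p: "u \<longlonglongrightarrow> p" using Cauchy_convergent convergentD by blast
  \<comment> \<open>Testing with reals \<open>r\<close> strictly below \<open>\<phi> p\<close> does
    not presuppose that \<open>\<phi> p\<close> is finite; finiteness follows afterwards, since all
    such \<open>r\<close> are bounded above.\<close>
  have bound: "r + 1 / 2 * (norm (p - w))\<^sup>2 \<le> m" if r: "ereal r < \<phi> p" for r
  proof (rule LIMSEQ_le)
    show "(\<lambda>n. r + 1 / 2 * (norm (u n - w))\<^sup>2) \<longlonglongrightarrow> r + 1 / 2 * (norm (p - w))\<^sup>2"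
      by (intro tendsto_intros p)
    show "(\<lambda>n. m + 1 / real (Suc n)) \<longlonglongrightarrow> m"
      using tendsto_add[OF tendsto_const LIMSEQ_Suc[OF lim_1_over_n], of m] by simp
    have "eventually (\<lambda>n. ereal r < \<phi> (u n)) sequentially"
      using lower_semicontinuous_eventually[OF assms(2) r] p unfolding filterlim_iff by blast
    then obtain N where "\<And>n. n \<ge> N \<Longrightarrow> ereal r < \<phi> (u n)"
      by (auto simp: eventually_sequentially)
    then have "r + 1 / 2 * (norm (u n - w))\<^sup>2 \<le> m + 1 / real (Suc n)" if "n \<ge> N" for n
      using ku[of n] k[of n] that by force
    then show "\<exists>N. \<forall>n\<ge>N. r + 1 / 2 * (norm (u n - w))\<^sup>2 \<le> m + 1 / real (Suc n)" by blast
  qed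
  have "\<phi> p \<le> ereal (m - 1 / 2 * (norm (p - w))\<^sup>2)"
  proof (rule ccontr)
    assume "\<not> ?thesis"
    then obtain r where "m - 1 / 2 * (norm (p - w))\<^sup>2 < r" "ereal r < \<phi> p"
      using ereal_dense2[of "ereal (m - 1 / 2 * (norm (p - w))\<^sup>2)" "\<phi> p"] by (auto simp: not_le)
    then show False using bound[of r] by simp
  qed
  then have "h p \<le> ereal m"
    using nm[of p] by (cases "\<phi> p") (auto simp: h_def)
  then have "h p \<le> h v" for v using hm[of v] by (rule order.trans)
  then show ?thesis
    unfolding h_def is_arg_min_linorder by blast
qed

text \<open>The objective at \<open>p\<close> is compared with its values on the segment from
  \<open>p\<close> to \<open>u\<close>. Strong convexity of \<phi> and of the square both contribute
  a multiple of \<open>s * (1 - s) * (norm (u - p))\<^sup>2\<close>, so their moduli add up to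
  \<open>1 + \<mu>\<close>.\<close>

lemma prox_three_point:
  fixes \<phi> :: "'a::{real_inner, complete_space} \<Rightarrow> ereal"
  assumes "proper \<phi>" "lower_semicontinuous \<phi>" "convex_ereal \<phi>"
    and sc: "convex_ereal (\<lambda>u. \<phi> u - ereal (\<mu> / 2 * (norm u)\<^sup>2))"
  obtains q where "\<phi> (prox \<phi> w) = ereal q"
    and "\<And>u r. \<phi> u = ereal r \<Longrightarrow> q + 1 / 2 * (norm (prox \<phi> w - w))\<^sup>2
           + (1 + \<mu>) / 2 * (norm (u - prox \<phi> w))\<^sup>2 \<le> r + 1 / 2 * (norm (u - w))\<^sup>2"
proof -
  have nm: "\<phi> u \<noteq> -\<infinity>" for u using assms(1) by (auto simp: proper_def)
  obtain x\<^sub>0 c where x0: "\<phi> x\<^sub>0 = ereal c"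
    using assms(1) unfolding proper_def by (metis ereal_cases)
  define p where "p = prox \<phi> w"
  have "is_arg_min (\<lambda>y. \<phi> y + ereal (1 / 2 * (norm (y - w))\<^sup>2)) (\<lambda>_. True) p"
    unfolding p_def prox_def arg_min_def
    by (rule someI_ex[OF prox_objective_minimizer_exists[OF assms(1-3)]])
  then have min: "\<phi> p + ereal (1 / 2 * (norm (p - w))\<^sup>2) \<le> \<phi> u + ereal (1 / 2 * (norm (u - w))\<^sup>2)" for u
    by (simp add: is_arg_min_linorder)
  obtain q where q: "\<phi> p = ereal q"
    using min[of x\<^sub>0] x0 nm[of p] by (cases "\<phi> p") auto
  have "q + 1 / 2 * (norm (p - w))\<^sup>2 + (1 + \<mu>) / 2 * (norm (u - p))\<^sup>2 \<le> r + 1 / 2 * (norm (u - w))\<^sup>2"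
    if u: "\<phi> u = ereal r" for u r
  proof -
    define D where "D = (norm (u - p))\<^sup>2"
    have ineq: "q + 1 / 2 * (norm (p - w))\<^sup>2 + (1 + \<mu>) / 2 * (1 - s) * D \<le> r + 1 / 2 * (norm (u - w))\<^sup>2"
      if s: "0 < s" "s < 1" for s :: real
    proof -
      define v where "v = (1 - s) *\<^sub>R p + s *\<^sub>R u"
      have nm': "\<phi> v - ereal (\<mu> / 2 * (norm v)\<^sup>2) \<noteq> -\<infinity>" for v
        using nm[of v] by (cases "\<phi> v") auto
      obtain k where k: "\<phi> v - ereal (\<mu> / 2 * (norm v)\<^sup>2) = ereal k"
          "k \<le> (1 - s) * (q - \<mu> / 2 * (norm p)\<^sup>2) + s * (r - \<mu> / 2 * (norm u)\<^sup>2)"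
        using convex_erealD[OF sc nm', of "1 - s" s p "q - \<mu> / 2 * (norm p)\<^sup>2" u "r - \<mu> / 2 * (norm u)\<^sup>2"]
          s q u by (auto simp: v_def)
      obtain l where l: "\<phi> v = ereal l" using k(1) by (cases "\<phi> v") auto
      have nv: "(norm v)\<^sup>2 = (1 - s) * (norm p)\<^sup>2 + s * (norm u)\<^sup>2 - s * (1 - s) * D"
        using norm_convex_comb_square[of s p u 0] by (simp add: v_def D_def)
      have "l = k + \<mu> / 2 * (norm v)\<^sup>2" using k(1) l by simp
      also have "\<mu> / 2 * (norm v)\<^sup>2 = (1 - s) * (\<mu> / 2 * (norm p)\<^sup>2) + s * (\<mu> / 2 * (norm u)\<^sup>2)
          - \<mu> / 2 * (s * (1 - s) * D)"
        unfolding nv by (simp add: field_simps)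
      finally have "l \<le> (1 - s) * q + s * r - \<mu> / 2 * (s * (1 - s) * D)"
        using k(2) by (simp add: right_diff_distrib)
      moreover have "q + 1 / 2 * (norm (p - w))\<^sup>2 \<le> l + 1 / 2 * (norm (v - w))\<^sup>2"
        using min[of v] q l by simp
      moreover have "(norm (v - w))\<^sup>2 = (1 - s) * (norm (p - w))\<^sup>2 + s * (norm (u - w))\<^sup>2 - s * (1 - s) * D"
        unfolding v_def D_def by (rule norm_convex_comb_square)
      \<comment> \<open>Subtracting \<open>1 - s\<close> times the objective at \<open>p\<close>
        leaves a factor \<open>s\<close> in every term, which can be divided out.\<close>
      ultimately have "s * (q + 1 / 2 * (norm (p - w))\<^sup>2 + (1 + \<mu>) / 2 * (1 - s) * D)
          \<le> s * (r + 1 / 2 * (norm (u - w))\<^sup>2)"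
        by (simp add: field_simps)
      then show ?thesis using s(1) by simp
    qed
    \<comment> \<open>Letting \<open>s\<close> decrease to 0 removes the remaining factor
      \<open>1 - s\<close> and restores the full modulus.\<close>
    have lim: "((\<lambda>s. q + 1 / 2 * (norm (p - w))\<^sup>2 + (1 + \<mu>) / 2 * (1 - s) * D) \<longlongrightarrow>
        q + 1 / 2 * (norm (p - w))\<^sup>2 + (1 + \<mu>) / 2 * (1 - 0) * D) (at_right (0::real))"
      by (intro tendsto_intros)
    have "eventually (\<lambda>s::real. 0 < s \<and> s < 1) (at_right 0)"
      unfolding eventually_at_right_field by (rule exI[of _ 1]) auto
    then have "eventually (\<lambda>s. q + 1 / 2 * (norm (p - w))\<^sup>2 + (1 + \<mu>) / 2 * (1 - s) * D
        \<le> r + 1 / 2 * (norm (u - w))\<^sup>2) (at_right 0)"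
      by (rule eventually_mono) (use ineq in blast)
    then show ?thesis
      using tendsto_upperbound[OF lim] by (simp add: D_def)
  qed
  then show ?thesis using that q unfolding p_def by blast
qed

section \<open>First-order inequalities for the smooth part\<close>

lemma GDERIV_line:
  assumes "GDERIV f (u + s *\<^sub>R d) :> D"
  shows "((\<lambda>s. f (u + s *\<^sub>R d)) has_real_derivative D \<bullet> d) (at s)"
proof -
  have "(f has_derivative (\<lambda>h. D \<bullet> h)) (at (u + s *\<^sub>R d))"
    using assms by (simp add: gderiv_def inner_commute)
  then have "((\<lambda>s. f (u + s *\<^sub>R d)) has_derivative (\<lambda>h. D \<bullet> (h *\<^sub>R d))) (at s)"
    by (rule has_derivative_compose[rotated]) (auto intro!: derivative_eq_intros)
  then show ?thesis
    by (simp add: has_field_derivative_def mult_commute_abs)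
qed

text \<open>Along the segment from \<open>u\<close> to \<open>v\<close>, Cauchy-Schwarz and the
  Lipschitz bound make the derivative of f minus its quadratic model nonpositive, so this difference
  does not increase.\<close>

lemma descent_lemma:
  fixes f :: "'a::real_inner \<Rightarrow> real"
  assumes f: "\<And>u. GDERIV f u :> df u" and L: "L-lipschitz_on UNIV df"
  shows "f v \<le> f u + df u \<bullet> (v - u) + L / 2 * (norm (v - u))\<^sup>2"
proof -
  define d where "d = v - u"
  let ?k = "\<lambda>s. f (u + s *\<^sub>R d) - s * (df u \<bullet> d) - L / 2 * s\<^sup>2 * (norm d)\<^sup>2"
  have "\<exists>D. (?k has_real_derivative D) (at s) \<and> D \<le> 0" if "0 \<le> s" for s
  proof (intro exI conjI)
    show "(?k has_real_derivative df (u + s *\<^sub>R d) \<bullet> d - df u \<bullet> d - L * s * (norm d)\<^sup>2) (at s)"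
      by (auto intro!: derivative_eq_intros GDERIV_line f)
    have "(df (u + s *\<^sub>R d) - df u) \<bullet> d \<le> norm (df (u + s *\<^sub>R d) - df u) * norm d"
      by (rule norm_cauchy_schwarz)
    also have "\<dots> \<le> (L * (s * norm d)) * norm d"
      using lipschitz_onD[OF L, of "u + s *\<^sub>R d" u] that
      by (intro mult_right_mono) (auto simp: dist_norm)
    finally show "df (u + s *\<^sub>R d) \<bullet> d - df u \<bullet> d - L * s * (norm d)\<^sup>2 \<le> 0"
      by (simp add: inner_diff_left power2_eq_square mult.assoc)
  qed
  then have "?k 1 \<le> ?k 0"
    by (intro DERIV_nonpos_imp_nonincreasing[of 0 1 ?k] zero_le_one)
  then show ?thesis by (simp add: d_def)
qed

text \<open>The tangent inequality for a convex function of one variable is applied, on the line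
  through \<open>u\<close> and \<open>v\<close>, to f minus the square. Expanding the subtracted
  squares gives back the quadratic term.\<close>

lemma strongly_convex_above_tangent:
  fixes f :: "'a::real_inner \<Rightarrow> real"
  assumes f: "GDERIV f u :> D" and c: "convex_on UNIV (\<lambda>u. f u - \<mu> / 2 * (norm u)\<^sup>2)"
  shows "f u + D \<bullet> (v - u) + \<mu> / 2 * (norm (v - u))\<^sup>2 \<le> f v"
proof -
  define d where "d = v - u"
  define h where "h = (\<lambda>u. f u - \<mu> / 2 * (norm u)\<^sup>2)"
  have "convex_on UNIV (\<lambda>s. h (u + s *\<^sub>R d))"
  proof (rule convex_onI)
    fix t x y :: real assume t: "0 < t" "t < 1"
    have "u + ((1 - t) *\<^sub>R x + t *\<^sub>R y) *\<^sub>R d = (1 - t) *\<^sub>R (u + x *\<^sub>R d) + t *\<^sub>R (u + y *\<^sub>R d)"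
      by (simp add: algebra_simps)
    then show "h (u + ((1 - t) *\<^sub>R x + t *\<^sub>R y) *\<^sub>R d)
        \<le> (1 - t) * h (u + x *\<^sub>R d) + t * h (u + y *\<^sub>R d)"
      using convex_onD[OF c, of t "u + x *\<^sub>R d" "u + y *\<^sub>R d"] t by (simp add: h_def)
  qed auto
  moreover have "((\<lambda>s. h (u + s *\<^sub>R d)) has_real_derivative D \<bullet> d - \<mu> * (u \<bullet> d)) (at 0)"
  proof -
    have "((\<lambda>s. f (u + s *\<^sub>R d)) has_real_derivative D \<bullet> d) (at 0)"
      using f by (intro GDERIV_line) simp
    moreover have "((\<lambda>s. (norm (u + s *\<^sub>R d))\<^sup>2) has_real_derivative 2 * (u \<bullet> d)) (at 0)"
      unfolding power2_norm_eq_inner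
      by (simp add: inner_simps inner_commute) (auto intro!: derivative_eq_intros)
    ultimately show ?thesis
      unfolding h_def using DERIV_diff[OF _ DERIV_cmult[of _ _ _ _ "\<mu> / 2"]] by fastforce
  qed
  ultimately have "h (u + 1 *\<^sub>R d) - h (u + 0 *\<^sub>R d) \<ge> (D \<bullet> d - \<mu> * (u \<bullet> d)) * (1 - 0)"
    by (intro convex_on_imp_above_tangent[where A = UNIV and c = 0 and x = 1]) auto
  then show ?thesis
    unfolding h_def d_def power2_norm_eq_inner
    by (simp add: inner_simps inner_commute algebra_simps)
qed

section \<open>Positive multiples of extended-valued functions\<close>

lemma proper_scale: "proper \<phi> \<Longrightarrow> 0 < b \<Longrightarrow> proper (\<lambda>u. ereal b * \<phi> u)"
  unfolding proper_def by (auto simp: ereal_mult_eq_MInfty ereal_mult_eq_PInfty)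

lemma lower_semicontinuous_scale:
  assumes "lower_semicontinuous \<phi>" "0 < b"
  shows "lower_semicontinuous (\<lambda>u. ereal b * \<phi> u)"
  unfolding lower_semicontinuous_def le_Liminf_iff
proof (intro allI impI)
  fix x c assume "c < ereal b * \<phi> x"
  then have "c / ereal b < \<phi> x" using assms(2) by (simp add: ereal_divide_less_pos)
  then have "eventually (\<lambda>u. c / ereal b < \<phi> u) (at x)"
    using lower_semicontinuous_eventually[OF assms(1)] by (simp add: eventually_nhds_conv_at)
  then show "eventually (\<lambda>u. c < ereal b * \<phi> u) (at x)"
    using assms(2) by (simp add: ereal_divide_less_pos)
qed

lemma convex_ereal_scale:
  assumes "convex_ereal \<phi>" "0 \<le> b"
  shows "convex_ereal (\<lambda>u. ereal b * \<phi> u)"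
  unfolding convex_ereal_def
proof (intro allI impI)
  fix x y and u v :: real assume "0 \<le> u" "0 \<le> v" "u + v = 1"
  then have "ereal b * \<phi> (u *\<^sub>R x + v *\<^sub>R y) \<le> ereal b * (ereal u * \<phi> x + ereal v * \<phi> y)"
    using assms by (intro ereal_mult_left_mono) (auto simp: convex_ereal_def)
  also have "\<dots> = ereal u * (ereal b * \<phi> x) + ereal v * (ereal b * \<phi> y)"
    using assms(2) by (simp add: ereal_pos_distrib mult.left_commute)
  finally show "ereal b * \<phi> (u *\<^sub>R x + v *\<^sub>R y)
      \<le> ereal u * (ereal b * \<phi> x) + ereal v * (ereal b * \<phi> y)" .
qed

section \<open>One iteration of the algorithm\<close>

text \<open>Function values enter as arbitrary reals tied only by the listed inequalities. This
  isolates the algebra from infinite values and leaves \<open>gx\<close> free when \<open>g\<close>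
  is infinite at \<open>x\<close>.\<close>

lemma apgd_step_real:
  fixes x y z x' z' xs d :: "'a::real_inner"
  assumes a: "a \<ge> (1::real)" and \<gamma>: "\<gamma> > 0" and \<mu>: "\<mu>\<^sub>f \<ge> 0"
    and y: "y = (1 - 1 / a) *\<^sub>R x + (1 / a) *\<^sub>R z"
    and x': "x' = (1 - 1 / a) *\<^sub>R x + (1 / a) *\<^sub>R z'"
    and descent: "fx' \<le> fy + d \<bullet> (x' - y) + L / 2 * (norm (x' - y))\<^sup>2"
    and tangent_s: "fy + d \<bullet> (xs - y) + \<mu>\<^sub>f / 2 * (norm (xs - y))\<^sup>2 \<le> fs"
    and tangent_x: "fy + d \<bullet> (x - y) + \<mu>\<^sub>f / 2 * (norm (x - y))\<^sup>2 \<le> fx"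
    and prox: "a * \<gamma> * gz + 1 / 2 * (norm (z' - (z - (a * \<gamma>) *\<^sub>R d)))\<^sup>2
        + (1 + a * \<gamma> * \<mu>\<^sub>g) / 2 * (norm (xs - z'))\<^sup>2
      \<le> a * \<gamma> * gs + 1 / 2 * (norm (xs - (z - (a * \<gamma>) *\<^sub>R d)))\<^sup>2"
    and gx': "gx' \<le> (1 - 1 / a) * gx + 1 / a * gz"
  shows "(1 + a * \<gamma> * \<mu>\<^sub>g) / (2 * \<gamma>) * (norm (z' - xs))\<^sup>2 + a\<^sup>2 * (fx' + gx' - (fs + gs))
    \<le> (1 - \<gamma> * \<mu>\<^sub>f) / (2 * \<gamma>) * (norm (z - xs))\<^sup>2 + (a\<^sup>2 - a) * (fx + gx - (fs + gs))
      - (1 / (2 * \<gamma>) - L / 2) * (norm (z' - z))\<^sup>2"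
proof -
  have a0: "a > 0" using a by simp
  have aa: "a\<^sup>2 - a \<ge> 0" using a by (simp add: power2_eq_square)
  \<comment> \<open>The previous point cancels, so the quadratic term of the descent inequality
    carries \<open>1 / a\<^sup>2\<close>, which the weight \<open>a\<^sup>2\<close> absorbs.\<close>
  have "x' - y = (1 / a) *\<^sub>R (z' - z)" by (simp add: x' y algebra_simps)
  then have "fx' \<le> fy + (d \<bullet> (z' - z)) / a + L / 2 * ((norm (z' - z))\<^sup>2 / a\<^sup>2)"
    using descent a0 by (simp add: power_divide)
  then have "a\<^sup>2 * fx' \<le> a\<^sup>2 * (fy + (d \<bullet> (z' - z)) / a + L / 2 * ((norm (z' - z))\<^sup>2 / a\<^sup>2))"
    by (rule mult_left_mono) simp
  also have "\<dots> = a\<^sup>2 * fy + a * (d \<bullet> (z' - z)) + L / 2 * (norm (z' - z))\<^sup>2"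
    using a0 by (simp add: field_simps power2_eq_square)
  finally have S1: "a\<^sup>2 * fx' \<le> a\<^sup>2 * fy + a * (d \<bullet> (z' - z)) + L / 2 * (norm (z' - z))\<^sup>2" .
  have S2: "a * (fy + d \<bullet> (xs - y) + \<mu>\<^sub>f / 2 * (norm (xs - y))\<^sup>2) \<le> a * fs"
    using tangent_s a0 by simp
  have S3: "(a\<^sup>2 - a) * (fy + d \<bullet> (x - y) + \<mu>\<^sub>f / 2 * (norm (x - y))\<^sup>2) \<le> (a\<^sup>2 - a) * fx"
    using tangent_x aa by (rule mult_left_mono)
  have "a *\<^sub>R y = (a - 1) *\<^sub>R x + z"
    using a0 by (simp add: y scaleR_right_distrib right_diff_distrib)
  then have z: "z = a *\<^sub>R y - (a - 1) *\<^sub>R x" by simp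
  have S4: "a * (d \<bullet> (xs - y)) + (a\<^sup>2 - a) * (d \<bullet> (x - y)) = a * (d \<bullet> (xs - z))"
    by (simp add: z inner_simps algebra_simps power2_eq_square)
  \<comment> \<open>With \<open>p = xs - y\<close> and \<open>q = x - y\<close> one has
    \<open>z - xs = - (p + (a - 1) *\<^sub>R q)\<close>; expanding leaves the defect below. Thus the
    strong convexity gains at \<open>y\<close> dominate the single term in
    \<open>z - xs\<close>.\<close>
  have "a * (norm (xs - y))\<^sup>2 + (a\<^sup>2 - a) * (norm (x - y))\<^sup>2 - (norm (z - xs))\<^sup>2
      = (a - 1) * (norm ((xs - y) - (x - y)))\<^sup>2"
    unfolding power2_norm_eq_inner z
    by (simp add: inner_simps inner_commute algebra_simps power2_eq_square)
  moreover have "\<dots> \<ge> 0" using a by simp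
  ultimately have "(norm (z - xs))\<^sup>2 \<le> a * (norm (xs - y))\<^sup>2 + (a\<^sup>2 - a) * (norm (x - y))\<^sup>2"
    by linarith
  then have S5: "\<mu>\<^sub>f / 2 * (norm (z - xs))\<^sup>2
      \<le> \<mu>\<^sub>f / 2 * (a * (norm (xs - y))\<^sup>2 + (a\<^sup>2 - a) * (norm (x - y))\<^sup>2)"
    using \<mu> by (intro mult_left_mono) auto
  define c where "c = 1 + a * \<gamma> * \<mu>\<^sub>g"
  \<comment> \<open>Both squares contain the same multiple of the squared norm of \<open>d\<close>,
    which cancels; only a term linear in \<open>d\<close> survives.\<close>
  have "(norm (xs - (z - (a * \<gamma>) *\<^sub>R d)))\<^sup>2 - (norm (z' - (z - (a * \<gamma>) *\<^sub>R d)))\<^sup>2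
      = (norm (z - xs))\<^sup>2 - (norm (z' - z))\<^sup>2 + 2 * (a * \<gamma>) * (d \<bullet> (xs - z'))"
    unfolding power2_norm_eq_inner
    by (simp add: inner_simps inner_commute algebra_simps)
  then have "a * \<gamma> * gz + (1 + a * \<gamma> * \<mu>\<^sub>g) / 2 * (norm (z' - xs))\<^sup>2 + 1 / 2 * (norm (z' - z))\<^sup>2
      \<le> a * \<gamma> * gs + 1 / 2 * (norm (z - xs))\<^sup>2 + a * \<gamma> * (d \<bullet> (xs - z'))"
    using prox by (simp add: norm_minus_commute[of xs z'])
  then have "(a * \<gamma> * gz + (1 + a * \<gamma> * \<mu>\<^sub>g) / 2 * (norm (z' - xs))\<^sup>2 + 1 / 2 * (norm (z' - z))\<^sup>2) / \<gamma>
      \<le> (a * \<gamma> * gs + 1 / 2 * (norm (z - xs))\<^sup>2 + a * \<gamma> * (d \<bullet> (xs - z'))) / \<gamma>"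
    using \<gamma> by (intro divide_right_mono) auto
  then have S6: "a * gz + (1 + a * \<gamma> * \<mu>\<^sub>g) / (2 * \<gamma>) * (norm (z' - xs))\<^sup>2 + 1 / (2 * \<gamma>) * (norm (z' - z))\<^sup>2
      \<le> a * gs + 1 / (2 * \<gamma>) * (norm (z - xs))\<^sup>2 + a * (d \<bullet> (xs - z'))"
    using \<gamma> unfolding c_def[symmetric] by (simp add: add_divide_distrib mult.commute)
  have "a\<^sup>2 * gx' \<le> a\<^sup>2 * ((1 - 1 / a) * gx + 1 / a * gz)"
    using gx' by (rule mult_left_mono) simp
  also have "\<dots> = (a\<^sup>2 - a) * gx + a * gz"
    using a0 by (simp add: field_simps power2_eq_square)
  finally have S7: "a\<^sup>2 * gx' \<le> (a\<^sup>2 - a) * gx + a * gz" .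
  \<comment> \<open>The gradient terms of the descent and prox inequalities combine to the one that
    \<open>S4\<close> extracts from the tangent inequalities.\<close>
  have S8: "a * (d \<bullet> (z' - z)) + a * (d \<bullet> (xs - z')) = a * (d \<bullet> (xs - z))"
    by (simp add: inner_simps algebra_simps)
  have S9: "(1 - \<gamma> * \<mu>\<^sub>f) / (2 * \<gamma>) * (norm (z - xs))\<^sup>2
      = 1 / (2 * \<gamma>) * (norm (z - xs))\<^sup>2 - \<mu>\<^sub>f / 2 * (norm (z - xs))\<^sup>2"
    using \<gamma> by (simp add: field_simps)
  show ?thesis
    using S1 S2 S3 S4 S5 S6 S7 S8 unfolding S9
    by (simp only: ring_distribs mult.left_commute[of "\<mu>\<^sub>f / 2"])
qed

text \<open>Since \<open>g\<close> is finite at \<open>xs\<close> and at the proximal point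
  \<open>z'\<close>, a case split on \<open>g x\<close> alone suffices to pass from real to extended
  values.\<close>

lemma apgd_step:
  fixes f :: "'a::{real_inner, complete_space} \<Rightarrow> real" and g :: "'a \<Rightarrow> ereal"
  assumes f: "\<And>u. GDERIV f u :> df u" "L-lipschitz_on UNIV df"
    "\<mu>\<^sub>f \<ge> 0" "convex_on UNIV (\<lambda>u. f u - \<mu>\<^sub>f / 2 * (norm u)\<^sup>2)"
    and g: "proper g" "lower_semicontinuous g" "convex_ereal g"
    "convex_ereal (\<lambda>u. g u - ereal (\<mu>\<^sub>g / 2 * (norm u)\<^sup>2))"
    and \<Psi>: "\<Psi> = (\<lambda>u. ereal (f u) + g u)" "\<Psi> xs \<noteq> \<infinity>"
    and a: "a \<ge> 1" and \<gamma>: "\<gamma> > 0"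
    and y: "y = (1 - 1 / a) *\<^sub>R x + (1 / a) *\<^sub>R z"
    and z': "z' = prox (\<lambda>u. ereal (a * \<gamma>) * g u) (z - (a * \<gamma>) *\<^sub>R df y)"
    and x': "x' = (1 - 1 / a) *\<^sub>R x + (1 / a) *\<^sub>R z'"
  shows "ereal ((1 + a * \<gamma> * \<mu>\<^sub>g) / (2 * \<gamma>) * (norm (z' - xs))\<^sup>2) + ereal (a\<^sup>2) * (\<Psi> x' - \<Psi> xs)
    \<le> ereal ((1 - \<gamma> * \<mu>\<^sub>f) / (2 * \<gamma>) * (norm (z - xs))\<^sup>2) + ereal (a\<^sup>2 - a) * (\<Psi> x - \<Psi> xs)
      - ereal ((1 / (2 * \<gamma>) - L / 2) * (norm (z' - z))\<^sup>2)"
proof -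
  have nm: "g u \<noteq> -\<infinity>" for u using g(1) by (auto simp: proper_def)
  have b: "a * \<gamma> > 0" using a \<gamma> by simp
  obtain gs where gs: "g xs = ereal gs" using \<Psi> nm[of xs] by (cases "g xs") auto
  \<comment> \<open>Multiplying \<open>g\<close> by \<open>a * \<gamma>\<close> multiplies its
    modulus likewise, which is the origin of the coefficient
    \<open>1 + a * \<gamma> * \<mu>\<^sub>g\<close>.\<close>
  have scale: "(\<lambda>u. ereal (a * \<gamma>) * (g u - ereal (\<mu>\<^sub>g / 2 * (norm u)\<^sup>2)))
      = (\<lambda>u. ereal (a * \<gamma>) * g u - ereal (a * \<gamma> * \<mu>\<^sub>g / 2 * (norm u)\<^sup>2))"
    (is "?l = ?r")
  proof
    show "?l u = ?r u" for u
      using nm[of u] b by (cases "g u") (auto simp: algebra_simps)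
  qed
  obtain q where q: "ereal (a * \<gamma>) * g z' = ereal q"
    and prox: "\<And>u r. ereal (a * \<gamma>) * g u = ereal r \<Longrightarrow>
      q + 1 / 2 * (norm (z' - (z - (a * \<gamma>) *\<^sub>R df y)))\<^sup>2 + (1 + a * \<gamma> * \<mu>\<^sub>g) / 2 * (norm (u - z'))\<^sup>2
        \<le> r + 1 / 2 * (norm (u - (z - (a * \<gamma>) *\<^sub>R df y)))\<^sup>2"
    using prox_three_point[OF proper_scale[OF g(1) b] lower_semicontinuous_scale[OF g(2) b]
        convex_ereal_scale[OF g(3) less_imp_le[OF b]]
        convex_ereal_scale[OF g(4) less_imp_le[OF b], unfolded scale]] z' by metis
  obtain gz where gz: "g z' = ereal gz" using q nm[of z'] b by (cases "g z'") (auto split: if_splits)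
  have q': "q = a * \<gamma> * gz" using q gz by simp
  have bound: "(1 + a * \<gamma> * \<mu>\<^sub>g) / (2 * \<gamma>) * (norm (z' - xs))\<^sup>2 + a\<^sup>2 * (f x' + gx' - (f xs + gs))
    \<le> (1 - \<gamma> * \<mu>\<^sub>f) / (2 * \<gamma>) * (norm (z - xs))\<^sup>2 + (a\<^sup>2 - a) * (f x + gx - (f xs + gs))
      - (1 / (2 * \<gamma>) - L / 2) * (norm (z' - z))\<^sup>2"
    if "gx' \<le> (1 - 1 / a) * gx + 1 / a * gz" for gx gx'
    using a \<gamma> f(3) y x' descent_lemma[OF f(1,2)]
      strongly_convex_above_tangent[OF f(1) f(4)] strongly_convex_above_tangent[OF f(1) f(4)]
      prox[of xs "a * \<gamma> * gs", unfolded q'] that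
    by (rule apgd_step_real) (simp add: gs)
  show ?thesis
  proof (cases "g x")
    case (real gx)
    obtain gx' where "g x' = ereal gx'" "gx' \<le> (1 - 1 / a) * gx + 1 / a * gz"
      using convex_erealD[OF g(3) nm, of "1 - 1 / a" "1 / a" x gx z' gz] a real gz x' by auto
    with real bound[of gx' gx] gs show ?thesis by (simp add: \<Psi>)
  next
    case PInf
    show ?thesis
    \<comment> \<open>For \<open>a = 1\<close> the term \<open>0 * \<infinity>\<close> vanishes, so any real number may stand in for \<open>g x\<close>.\<close>
    proof (cases "a = 1")
      case True
      then have "x' = z'" using x' by simp
      with True bound[of gz 0] gs gz show ?thesis
        by (simp add: \<Psi> flip: zero_ereal_def)
    next
      case False
      \<comment> \<open>The positive coefficient makes the right-hand side infinite, so the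
        inequality is trivial.\<close>
      then have "a\<^sup>2 - a > 0" using a by (simp add: power2_eq_square)
      then show ?thesis using PInf gs by (simp add: \<Psi>)
    qed
  qed (use nm in auto)
qed

section \<open>Contraction of the energy\<close>

text \<open>
  \<open>deg\<close> covers \<open>b = 0\<close> with \<open>a' > 1\<close>: there \<open>R = \<infinity>\<close>, but \<open>\<infinity> * 0 = 0\<close> on the right-hand side if \<open>N = 0\<close>.
  In the algorithm it holds because \<open>b = 0\<close> only occurs at \<open>t = 0\<close>, where \<open>z 0 = x 0\<close>.
\<close>

lemma energy_contraction:
  fixes D R :: ereal
  assumes \<gamma>: "\<gamma> > 0" and b: "b \<ge> (0::real)" and a': "a' \<ge> 1" and \<mu>: "\<mu>\<^sub>g \<ge> 0" and N: "N \<ge> 0"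
    and D: "D \<ge> 0" and deg: "b = 0 \<Longrightarrow> N = 0 \<Longrightarrow> D = 0"
    and R: "R = ereal (a'\<^sup>2 - a') / ereal (b\<^sup>2)"
  shows "ereal ((1 - \<gamma> * \<mu>\<^sub>f) / (2 * \<gamma>) * N) + ereal (a'\<^sup>2 - a') * D
    \<le> max (ereal ((1 - \<gamma> * \<mu>\<^sub>f) / (1 + b * \<gamma> * \<mu>\<^sub>g))) R
      * (ereal ((1 + b * \<gamma> * \<mu>\<^sub>g) / (2 * \<gamma>) * N) + ereal (b\<^sup>2) * D)"
proof -
  define \<rho> where "\<rho> = (1 - \<gamma> * \<mu>\<^sub>f) / (1 + b * \<gamma> * \<mu>\<^sub>g)"
  define K where "K = (1 + b * \<gamma> * \<mu>\<^sub>g) / (2 * \<gamma>)"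
  define M where "M = max (ereal \<rho>) R"
  have pos: "1 + b * \<gamma> * \<mu>\<^sub>g > 0" using \<gamma> b \<mu> by (simp add: add_pos_nonneg)
  then have K: "K > 0" using \<gamma> by (simp add: K_def)
  have aa: "a'\<^sup>2 - a' \<ge> 0" using a' by (simp add: power2_eq_square)
  \<comment> \<open>Distributivity over extended values is available because both summands are
    nonnegative.\<close>
  have split: "M * (ereal (K * N) + ereal (b\<^sup>2) * D) = M * ereal (K * N) + M * (ereal (b\<^sup>2) * D)"
    using K N D by (intro ereal_right_distrib) auto
  have "(1 - \<gamma> * \<mu>\<^sub>f) / (2 * \<gamma>) * N = \<rho> * (K * N)"
    using pos by (simp add: \<rho>_def K_def)
  then have "ereal ((1 - \<gamma> * \<mu>\<^sub>f) / (2 * \<gamma>) * N) = ereal \<rho> * ereal (K * N)" by simp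
  also have "\<dots> \<le> M * ereal (K * N)"
    unfolding M_def using K N by (intro ereal_mult_right_mono) auto
  finally have A: "ereal ((1 - \<gamma> * \<mu>\<^sub>f) / (2 * \<gamma>) * N) \<le> M * ereal (K * N)" .
  have "ereal ((1 - \<gamma> * \<mu>\<^sub>f) / (2 * \<gamma>) * N) + ereal (a'\<^sup>2 - a') * D
      \<le> M * (ereal (K * N) + ereal (b\<^sup>2) * D)"
  proof (cases "b = 0")
    case False
    then have "ereal (a'\<^sup>2 - a') * D = R * (ereal (b\<^sup>2) * D)"
      unfolding R mult.assoc[symmetric] by simp
    also have "\<dots> \<le> M * (ereal (b\<^sup>2) * D)"
      unfolding M_def using D by (intro ereal_mult_right_mono) auto
    finally show ?thesis unfolding split using A by (rule add_mono[rotated])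
  next
    case b0: True
    show ?thesis
    proof (cases "a' = 1 \<or> N = 0")
      case True
      \<comment> \<open>Either the coefficient is zero, and kills even an infinite \<open>D\<close>,
        or \<open>D\<close> itself vanishes by \<open>deg\<close>.\<close>
      then have B: "ereal (a'\<^sup>2 - a') * D = 0" using deg b0 by auto
      show ?thesis unfolding B using A b0 by (simp flip: zero_ereal_def)
    next
      case False
      then have pos: "a'\<^sup>2 - a' > 0" "N > 0" using a' N by (auto simp: power2_eq_square)
      \<comment> \<open>A positive number divided by zero is infinite, and the factor
        \<open>K * N\<close> is positive, so the right-hand side is infinite.\<close>
      then have "M = \<infinity>" using b0 by (auto simp: M_def R divide_ereal_def max_def)
      then show ?thesis using b0 K pos by (simp flip: zero_ereal_def)
    qed
  qed
  then show ?thesis by (simp only: M_def \<rho>_def K_def)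
qed

theorem theorem2p1:
  fixes f :: "'a::{real_inner, complete_space} \<Rightarrow> real"
    and df :: "'a \<Rightarrow> 'a"
    and g \<Psi> :: "'a \<Rightarrow> ereal"
    and L\<^sub>f \<mu>\<^sub>f \<mu>\<^sub>g \<gamma> :: real
    and a :: "nat \<Rightarrow> real"
    and x y z :: "nat \<Rightarrow> 'a"
    and xs :: 'a
  assumes "convex_on UNIV f"
    and "\<And>u. GDERIV f u :> df u"
    and "L\<^sub>f > 0" and "L\<^sub>f-lipschitz_on UNIV df"
    and "proper g" and "lower_semicontinuous g" and "convex_ereal g"
    and "\<mu>\<^sub>f \<ge> 0" and "convex_on UNIV (\<lambda>u. f u - \<mu>\<^sub>f / 2 * (norm u)\<^sup>2)"
    and "\<mu>\<^sub>g \<ge> 0" and "convex_ereal (\<lambda>u. g u - ereal (\<mu>\<^sub>g / 2 * (norm u)\<^sup>2))"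
    and "\<Psi> = (\<lambda>u. ereal (f u) + g u)"
    and "is_arg_min \<Psi> (\<lambda>_. True) xs"
    and "\<gamma> > 0" and "a 0 \<ge> 0" and "\<And>t. t \<ge> 1 \<Longrightarrow> a t \<ge> 1"
    and "apgd_iterates df g \<gamma> a x y z"
  shows "(\<forall>t.
       ereal ((1 + a (Suc t) * \<gamma> * \<mu>\<^sub>g) / (2 * \<gamma>) * (norm (z (Suc t) - xs))\<^sup>2)
         + ereal ((a (Suc t))\<^sup>2) * (\<Psi> (x (Suc t)) - \<Psi> xs)
       \<le> ereal ((1 - \<gamma> * \<mu>\<^sub>f) / (2 * \<gamma>) * (norm (z t - xs))\<^sup>2)
         + ereal ((a (Suc t))\<^sup>2 - a (Suc t)) * (\<Psi> (x t) - \<Psi> xs)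
         - ereal ((1 / (2 * \<gamma>) - L\<^sub>f / 2) * (norm (z (Suc t) - z t))\<^sup>2))
    \<and> (\<gamma> \<le> 1 / L\<^sub>f \<longrightarrow> (\<forall>t.
       energy \<Psi> \<gamma> \<mu>\<^sub>g a x z xs (Suc t)
       \<le> max (ereal ((1 - \<gamma> * \<mu>\<^sub>f) / (1 + a t * \<gamma> * \<mu>\<^sub>g))) (momentum_ratio a t)
         * energy \<Psi> \<gamma> \<mu>\<^sub>g a x z xs t))"
proof -
  note \<Psi> = \<open>\<Psi> = (\<lambda>u. ereal (f u) + g u)\<close>
  have min: "\<Psi> xs \<le> \<Psi> u" for u
    using \<open>is_arg_min \<Psi> (\<lambda>_. True) xs\<close> by (simp add: is_arg_min_linorder)
  obtain u\<^sub>0 where "g u\<^sub>0 \<noteq> \<infinity>" using \<open>proper g\<close> by (auto simp: proper_def)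
  then have "\<Psi> u\<^sub>0 \<noteq> \<infinity>" by (simp add: \<Psi>)
  \<comment> \<open>Finiteness of the optimal value rules out the undetermined difference of two
    infinities in the gaps.\<close>
  then have fin: "\<Psi> xs \<noteq> \<infinity>" using min[of u\<^sub>0] by auto
  have "g xs \<noteq> -\<infinity>" using \<open>proper g\<close> by (auto simp: proper_def)
  then have gap: "\<Psi> u - \<Psi> xs \<ge> 0" for u
    using min[of u] fin by (simp add: \<Psi> ereal_diff_positive)
  have iter: "z 0 = x 0"
    "y t = (1 - 1 / a (Suc t)) *\<^sub>R x t + (1 / a (Suc t)) *\<^sub>R z t"
    "z (Suc t) = prox (\<lambda>u. ereal (a (Suc t) * \<gamma>) * g u) (z t - (a (Suc t) * \<gamma>) *\<^sub>R df (y t))"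
    "x (Suc t) = (1 - 1 / a (Suc t)) *\<^sub>R x t + (1 / a (Suc t)) *\<^sub>R z (Suc t)" for t
    using \<open>apgd_iterates df g \<gamma> a x y z\<close> by (auto simp: apgd_iterates_def)
  have step: "ereal ((1 + a (Suc t) * \<gamma> * \<mu>\<^sub>g) / (2 * \<gamma>) * (norm (z (Suc t) - xs))\<^sup>2)
         + ereal ((a (Suc t))\<^sup>2) * (\<Psi> (x (Suc t)) - \<Psi> xs)
       \<le> ereal ((1 - \<gamma> * \<mu>\<^sub>f) / (2 * \<gamma>) * (norm (z t - xs))\<^sup>2)
         + ereal ((a (Suc t))\<^sup>2 - a (Suc t)) * (\<Psi> (x t) - \<Psi> xs)
         - ereal ((1 / (2 * \<gamma>) - L\<^sub>f / 2) * (norm (z (Suc t) - z t))\<^sup>2)" for t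
    by (rule apgd_step[OF assms(2,4,8,9,5,6,7,11,12) fin assms(16,14) iter(2-4)]) simp
  have "energy \<Psi> \<gamma> \<mu>\<^sub>g a x z xs (Suc t)
       \<le> max (ereal ((1 - \<gamma> * \<mu>\<^sub>f) / (1 + a t * \<gamma> * \<mu>\<^sub>g))) (momentum_ratio a t)
         * energy \<Psi> \<gamma> \<mu>\<^sub>g a x z xs t" if "\<gamma> \<le> 1 / L\<^sub>f" for t
  proof -
    \<comment> \<open>The stepsize bound is used exactly here, to discard the term in
      \<open>z (Suc t) - z t\<close>.\<close>
    have "0 \<le> (1 / (2 * \<gamma>) - L\<^sub>f / 2) * (norm (z (Suc t) - z t))\<^sup>2"
      using that \<open>L\<^sub>f > 0\<close> \<open>\<gamma> > 0\<close> by (intro mult_nonneg_nonneg) (auto simp: field_simps)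
    then have drop: "e - ereal ((1 / (2 * \<gamma>) - L\<^sub>f / 2) * (norm (z (Suc t) - z t))\<^sup>2) \<le> e" for e
      by (cases e) auto
    have a: "a t \<ge> 0" "t \<noteq> 0 \<Longrightarrow> a t \<noteq> 0"
      using assms(15) assms(16)[of t] by (cases t; force)+
    show ?thesis
      unfolding energy_def
    proof (rule order.trans[OF step order.trans[OF drop energy_contraction]])
      show "\<Psi> (x t) - \<Psi> xs = 0" if "a t = 0" "(norm (z t - xs))\<^sup>2 = 0"
      proof -
        have "t = 0" using a that(1) by blast
        then have "x t = xs" using that(2) iter(1) by simp
        then show ?thesis using fin \<open>g xs \<noteq> -\<infinity>\<close> by (cases "g xs") (auto simp: \<Psi>)
      qed
    qed (use a gap assms(10,14) assms(16)[of "Suc t"] in \<open>auto simp: momentum_ratio_def\<close>)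
  qed
  with step show ?thesis by blast
qed

end
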